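(* Let $n\ge2$, let $f$ be $L$-smooth and $\zeta$-quasar-convex with respect to $x^*\in\mathcal{X}^*$, let the interpolation condition hold at $x^*$, and let each $f_i$ be $L_i$-smooth. If $v$ is a $b$-minibatch sampling, $1\le b\le n$, and for all $k$ $$\gamma_k\equiv\frac12\,\frac{\zeta(n-1)b}{2L_{\max}(n-b)+L(n-1)b},$$ then the iterates of SGD satisfy, for all $k\ge1$, with $r_0=\|x^0-x^*\|^2$, $$\min_{t=0,\dots,k-1}\mathbb{E}[f(x^t)-f(x^* )]\le\frac{2L_{\max}(n-b)+L(n-1)b}{\zeta^2(n-1)b}\,\frac{2r_0}{k}.$$ Consequently, for $\epsilon>0$, the total complexity (number of iterations times the minibatch size $b$) needed to guarantee $\min_{t=0,\dots,k-1}\mathbb{E}[f(x^t)-f(x^* )]\le\epsilon$ satisfies $$TC(b)\le\frac{2(n-b)L_{\max}+(n-1)bL}{\zeta^2(n-1)}\,\frac{2r_0}{\epsilon},$$ in the sense that the guarantee holds for every $k$ such that $kb$ is at least the right-hand side. The minibatch size $b^*\in\{1,\dots,n\}$ minimizing this total complexity bound is $$b^*=\begin{cases}1&\text{if } n-1\ge 2L_{\max}/L,\\ n&\text{if } n-1<2L_{\max}/L.\end{cases}$$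
   Context: $f_1,\dots,f_n:\mathbb{R}^d\to\mathbb{R}$ are differentiable, $f=\frac1n\sum_i f_i$, and the set $\mathcal{X}^*$ of global minimizers of $f$ is nonempty. The $b$-minibatch sampling is the random vector $v\in\mathbb{R}^n$ with $\mathbb{P}[v=\frac nb\sum_{i\in S}e_i]=1/\binom nb$ for every $S\subset\{1,\dots,n\}$, $|S|=b$. $f_v=\frac1n\sum_iv_if_i$. SGD from a deterministic $x^0$: $x^{k+1}=x^k-\gamma_k\nabla f_{v^k}(x^k)$, with $v^0,v^1,\dots$ i.i.d. copies of $v$. A function $h$ is $L$-smooth ($L>0$) if $h(z)-h(x)\le\langle\nabla h(x),z-x\rangle+\frac L2\|z-x\|^2$ for all $x,z$; $L_{\max}=\max_iL_i$. For $\zeta\in(0,1]$, $f$ is $\zeta$-quasar-convex with respect to $x^*$ if $f(x^* )\ge f(x)+\frac1\zeta\langle\nabla f(x),x^*-x\rangle$ for all $x$. Interpolation at $x^*$: $f_i(x^* )=\min_xf_i(x)$ for all $i$. *)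

theory Defs
  imports "HOL-Probability.Probability"
begin

text \<open>The library has the relation \<open>GDERIV h x :> g\<close> but no gradient function. For
  differentiable \<open>h\<close> the description below is well defined, see \<open>GDERIV_grad\<close>.\<close>

definition grad :: "('a::euclidean_space \<Rightarrow> real) \<Rightarrow> 'a \<Rightarrow> 'a" where
  "grad h x = (THE g. GDERIV h x :> g)"

lemma GDERIV_unique_euclidean:
  fixes h :: "'a::euclidean_space \<Rightarrow> real"
  assumes "GDERIV h x :> g" "GDERIV h x :> g'"
  shows "g = g'"
proof -
  have "(\<lambda>y. y \<bullet> g) = (\<lambda>y. y \<bullet> g')"
    using assms unfolding gderiv_def by (rule has_derivative_unique)
  then have "y \<bullet> g = y \<bullet> g'" for y
    by (rule fun_cong)
  then show ?thesis
    using vector_eq_ldot[of g g'] by blast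
qed

lemma GDERIV_grad:
  fixes h :: "'a::euclidean_space \<Rightarrow> real"
  assumes "h differentiable (at x)"
  shows "GDERIV h x :> grad h x"
proof -
  obtain D where D: "(h has_derivative D) (at x)"
    using assms unfolding differentiable_def by blast
  then have lin: "linear D"
    using has_derivative_linear by blast
  have "D = (\<lambda>y. y \<bullet> adjoint D 1)"
  proof
    fix y
    show "D y = y \<bullet> adjoint D 1"
      by (simp only: adjoint_works[OF lin] inner_real_def mult_1_right)
  qed
  then have "GDERIV h x :> adjoint D 1"
    unfolding gderiv_def using has_derivative_eq_rhs[OF D] by blast
  then show ?thesis
    unfolding grad_def by (rule theI) (rule GDERIV_unique_euclidean[OF _ \<open>GDERIV h x :> adjoint D 1\<close>])
qed

definition smooth_with :: "real \<Rightarrow> ('a::euclidean_space \<Rightarrow> real) \<Rightarrow> bool" where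
  "smooth_with L h \<longleftrightarrow> L > 0 \<and>
     (\<forall>x z. h z - h x \<le> grad h x \<bullet> (z - x) + L / 2 * (norm (z - x))\<^sup>2)"

definition quasar_convex :: "real \<Rightarrow> ('a::euclidean_space \<Rightarrow> real) \<Rightarrow> 'a \<Rightarrow> bool" where
  "quasar_convex \<zeta> h xs \<longleftrightarrow> 0 < \<zeta> \<and> \<zeta> \<le> 1 \<and>
     (\<forall>x. h xs \<ge> h x + 1 / \<zeta> * (grad h x \<bullet> (xs - x)))"

definition minimizers :: "('a \<Rightarrow> real) \<Rightarrow> 'a set" where
  "minimizers h = {x. \<forall>y. h x \<le> h y}"

definition interpolation :: "('n \<Rightarrow> 'a \<Rightarrow> real) \<Rightarrow> 'a \<Rightarrow> bool" where
  "interpolation f xs \<longleftrightarrow> (\<forall>i. xs \<in> minimizers (f i))"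

text \<open>The summands are indexed by a finite type \<open>'n\<close>, so that \<open>n = CARD('n)\<close> and random weights
  \<open>v\<close> live in \<open>real^'n\<close>.\<close>

definition average :: "('n::finite \<Rightarrow> 'a \<Rightarrow> real) \<Rightarrow> 'a \<Rightarrow> real" where
  "average f x = 1 / real CARD('n) * (\<Sum>i\<in>UNIV. f i x)"

definition weighted_average :: "('n::finite \<Rightarrow> 'a \<Rightarrow> real) \<Rightarrow> real^'n \<Rightarrow> 'a \<Rightarrow> real" where
  "weighted_average f v x = 1 / real CARD('n) * (\<Sum>i\<in>UNIV. v $ i * f i x)"

definition minibatch_sampling :: "'w measure \<Rightarrow> nat \<Rightarrow> ('w \<Rightarrow> real^'n::finite) \<Rightarrow> bool" where
  "minibatch_sampling M b v \<longleftrightarrow> prob_space M \<and> v \<in> borel_measurable M \<and>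
     (\<forall>S::'n set. card S = b \<longrightarrow>
        measure M {w \<in> space M. v w = (real CARD('n) / real b) *\<^sub>R (\<Sum>i\<in>S. axis i 1)}
          = 1 / real (CARD('n) choose b))"

definition iid_copies ::
  "'w measure \<Rightarrow> (nat \<Rightarrow> 'w \<Rightarrow> 'b::topological_space) \<Rightarrow> 'u measure \<Rightarrow> ('u \<Rightarrow> 'b) \<Rightarrow> bool" where
  "iid_copies M V N v \<longleftrightarrow> prob_space M \<and> prob_space.indep_vars M (\<lambda>_. borel) V UNIV \<and>
     (\<forall>k. distr M borel (V k) = distr N borel v)"

text \<open>Pathwise iterates: \<open>vs\<close> is one realisation of the weight sequence.\<close>

primrec sgd :: "('n::finite \<Rightarrow> 'a::euclidean_space \<Rightarrow> real) \<Rightarrow> (nat \<Rightarrow> real) \<Rightarrow> 'a \<Rightarrow>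
    (nat \<Rightarrow> real^'n) \<Rightarrow> nat \<Rightarrow> 'a" where
  "sgd f \<gamma> x0 vs 0 = x0"
| "sgd f \<gamma> x0 vs (Suc k) =
     sgd f \<gamma> x0 vs k - \<gamma> k *\<^sub>R grad (weighted_average f (vs k)) (sgd f \<gamma> x0 vs k)"

definition expected_gap :: "'w measure \<Rightarrow> ('n::finite \<Rightarrow> 'a::euclidean_space \<Rightarrow> real) \<Rightarrow> 'a \<Rightarrow>
    (nat \<Rightarrow> 'w \<Rightarrow> 'a) \<Rightarrow> nat \<Rightarrow> real" where
  "expected_gap M f xs X t = (\<integral>w. (average f (X t w) - average f xs) \<partial>M)"

definition complexity_bound ::
  "nat \<Rightarrow> real \<Rightarrow> real \<Rightarrow> real \<Rightarrow> real \<Rightarrow> real \<Rightarrow> nat \<Rightarrow> real" where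
  "complexity_bound n L Lmax \<zeta> r0 \<epsilon> b =
     (2 * (real n - real b) * Lmax + (real n - 1) * real b * L) / (\<zeta>\<^sup>2 * (real n - 1)) * (2 * r0 / \<epsilon>)"

end

theory Submission
  imports Defs
begin

text \<open>Quasar-convexity bounds the drift of \<open>\<parallel>x\<^sup>k - x\<^sup>*\<parallel>\<^sup>2\<close> by the gap \<open>f x\<^sup>k - f x\<^sup>*\<close>, so it remains
  to bound the second moment of the stochastic gradient by the gap as well. For a uniformly random
  \<open>b\<close>-subset this moment is an explicit combination of \<open>\<parallel>\<nabla>f\<parallel>\<^sup>2\<close> and the mean of the
  \<open>\<parallel>\<nabla>f\<^sub>i\<parallel>\<^sup>2\<close>; smoothness bounds the former by \<open>2 L\<close> times the gap, and, since
  \<open>x\<^sup>*\<close> minimizes every \<open>f\<^sub>i\<close>, the latter by \<open>2 L\<^sub>m\<^sub>a\<^sub>x\<close> times the gap. As the \<open>k\<close>-th iterate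
  depends only on the first \<open>k\<close> samples, integrating the one-step inequality and telescoping gives
  the rate. The complexity bound is affine in \<open>b\<close>, hence minimal at an endpoint.\<close>

section \<open>Gradients\<close>

lemma grad_eqI:
  assumes "GDERIV h x :> g"
  shows "grad h x = g"
  unfolding grad_def using assms by (blast intro: GDERIV_unique_euclidean)

lemma GDERIV_sum_cmult:
  fixes h :: "'i \<Rightarrow> 'a::real_inner \<Rightarrow> real"
  assumes "\<And>i. i \<in> I \<Longrightarrow> GDERIV (h i) x :> g i"
  shows "GDERIV (\<lambda>x. \<Sum>i\<in>I. c i * h i x) x :> (\<Sum>i\<in>I. c i *\<^sub>R g i)"
proof -
  have "((\<lambda>x. \<Sum>i\<in>I. c i * h i x) has_derivative (\<lambda>y. \<Sum>i\<in>I. c i * (y \<bullet> g i))) (at x)"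
    using assms unfolding gderiv_def by (intro has_derivative_sum has_derivative_mult_right) auto
  then show ?thesis
    unfolding gderiv_def by (simp add: inner_sum_right)
qed

lemma grad_weighted_average:
  assumes "\<And>i. f i differentiable (at x)"
  shows "grad (weighted_average f v) x =
    (1 / real CARD('n)) *\<^sub>R (\<Sum>i\<in>UNIV. v $ i *\<^sub>R grad (f (i::'n::finite)) x)"
proof (rule grad_eqI)
  have "weighted_average f v = (\<lambda>x. \<Sum>i\<in>UNIV. (1 / real CARD('n) * v $ i) * f i x)"
    by (rule ext) (simp add: weighted_average_def sum_distrib_left mult.assoc)
  then show "GDERIV (weighted_average f v) x :> (1 / real CARD('n)) *\<^sub>R (\<Sum>i\<in>UNIV. v $ i *\<^sub>R grad (f i) x)"
    using GDERIV_sum_cmult[of UNIV f x "\<lambda>i. grad (f i) x" "\<lambda>i. 1 / real CARD('n) * v $ i"]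
      GDERIV_grad[OF assms]
    by (simp add: scaleR_right.sum)
qed

lemma grad_average:
  assumes "\<And>i. f i differentiable (at x)"
  shows "grad (average f) x = (1 / real CARD('n)) *\<^sub>R (\<Sum>i\<in>UNIV. grad (f (i::'n::finite)) x)"
proof -
  have "average f = weighted_average f (\<chi> i. 1)"
    by (rule ext) (simp add: average_def weighted_average_def)
  then show ?thesis
    using grad_weighted_average[OF assms, where v = "\<chi> i. 1"] by simp
qed

text \<open>A gradient that exists everywhere may still be discontinuous. Each coordinate, however,
  is a pointwise limit of difference quotients of \<open>h\<close>, and these are measurable because
  a differentiable \<open>h\<close> is continuous.\<close>

lemma borel_measurable_grad:
  fixes h :: "'a::euclidean_space \<Rightarrow> real"
  assumes diff: "\<And>x. h differentiable (at x)"
  shows "grad h \<in> borel_measurable borel"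
proof (subst borel_measurable_euclidean_space, intro ballI)
  fix e :: 'a
  have cont: "continuous_on UNIV h"
    using diff by (simp add: continuous_at_imp_continuous_on differentiable_imp_continuous_within)
  have [measurable]: "h \<in> borel_measurable borel"
    using cont by (rule borel_measurable_continuous_onI)
  show "(\<lambda>x. grad h x \<bullet> e) \<in> borel_measurable borel"
  proof (rule borel_measurable_LIMSEQ_real)
    fix x
    have "(h has_derivative (\<lambda>y. y \<bullet> grad h x)) (at (x + 0 *\<^sub>R e))"
      using GDERIV_grad[OF diff] by (simp add: gderiv_def)
    moreover have "((\<lambda>t. x + t *\<^sub>R e) has_derivative (\<lambda>t. t *\<^sub>R e)) (at 0)"
      by (auto intro!: derivative_eq_intros)
    ultimately have "((\<lambda>t. h (x + t *\<^sub>R e)) has_derivative (\<lambda>t. (t *\<^sub>R e) \<bullet> grad h x)) (at 0)"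
      by (rule has_derivative_compose[rotated])
    then have "((\<lambda>t. h (x + t *\<^sub>R e)) has_field_derivative (grad h x \<bullet> e)) (at 0)"
      by (simp add: has_field_derivative_def inner_commute mult_commute_abs)
    then have "((\<lambda>t. (h (x + t *\<^sub>R e) - h x) / t) \<longlongrightarrow> grad h x \<bullet> e) (at 0)"
      by (simp add: DERIV_def)
    \<comment> \<open>\<open>Suc n\<close> keeps the increments finite and nonzero, as the punctured
      filter \<open>at 0\<close> requires.\<close>
    moreover have "filterlim (\<lambda>n. 1 / real (Suc n)) (at 0) sequentially"
      by (rule filterlim_atI) (use LIMSEQ_inverse_real_of_nat in \<open>auto simp: inverse_eq_divide\<close>)
    ultimately show "(\<lambda>n. (h (x + (1 / real (Suc n)) *\<^sub>R e) - h x) / (1 / real (Suc n)))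
        \<longlonglongrightarrow> grad h x \<bullet> e"
      by (rule filterlim_compose)
  qed measurable
qed

text \<open>A gradient step of length \<open>1 / L\<close> minimizes the quadratic upper bound and
  lowers \<open>h\<close> by at least \<open>(norm (grad h x))\<^sup>2 / (2 * L)\<close>; it cannot
  go below the minimum \<open>h xs\<close>.\<close>

lemma smooth_with_grad_le:
  assumes "smooth_with L h" "\<And>y. h xs \<le> h y"
  shows "(norm (grad h x))\<^sup>2 \<le> 2 * L * (h x - h xs)"
proof -
  let ?g = "grad h x" and ?z = "x - (1 / L) *\<^sub>R grad h x"
  have L: "L > 0" and "h ?z - h x \<le> ?g \<bullet> (?z - x) + L / 2 * (norm (?z - x))\<^sup>2"
    using assms(1) unfolding smooth_with_def by blast+
  then have "h ?z - h x \<le> - (norm ?g)\<^sup>2 / L + L / 2 * ((norm ?g)\<^sup>2 / L\<^sup>2)"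
    by (simp add: power_divide flip: power2_norm_eq_inner)
  also have "\<dots> = - (norm ?g)\<^sup>2 / (2 * L)"
    using L by (simp add: field_simps power2_eq_square)
  finally have "(norm ?g)\<^sup>2 / (2 * L) \<le> h x - h xs"
    using assms(2)[of ?z] by simp
  then show ?thesis
    using L by (simp add: pos_divide_le_eq mult.commute)
qed

section \<open>Moments of a uniformly random subset of fixed size\<close>

text \<open>Such an \<open>S\<close> is \<open>T\<close> together with an arbitrary subset of
  \<open>A - T\<close> of the remaining size. The assumption \<open>card T \<le> k\<close> is what
  makes the truncated difference \<open>k - card T\<close> that size.\<close>

lemma card_subsets_containing:
  assumes "finite A" "T \<subseteq> A" "card T \<le> k"
  shows "card {S. T \<subseteq> S \<and> S \<subseteq> A \<and> card S = k} = (card A - card T) choose (k - card T)"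
proof -
  have fin: "finite T" using assms finite_subset by blast
  have "bij_betw (\<lambda>S. S \<union> T) {S. S \<subseteq> A - T \<and> card S = k - card T}
      {S. T \<subseteq> S \<and> S \<subseteq> A \<and> card S = k}"
  proof (rule bij_betw_byWitness[where f' = "\<lambda>S. S - T"])
    show "(\<lambda>S. S \<union> T) ` {S. S \<subseteq> A - T \<and> card S = k - card T} \<subseteq> {S. T \<subseteq> S \<and> S \<subseteq> A \<and> card S = k}"
    proof clarify
      fix S assume S: "S \<subseteq> A - T" "card S = k - card T"
      then have "card (S \<union> T) = card S + card T"
        using assms fin by (intro card_Un_disjoint) (auto intro: finite_subset)
      then show "T \<subseteq> S \<union> T \<and> S \<union> T \<subseteq> A \<and> card (S \<union> T) = k"
        using S assms by auto
    qed
    show "(\<lambda>S. S - T) ` {S. T \<subseteq> S \<and> S \<subseteq> A \<and> card S = k} \<subseteq> {S. S \<subseteq> A - T \<and> card S = k - card T}"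
      using fin by (auto simp: card_Diff_subset)
  qed auto
  then have "card {S. T \<subseteq> S \<and> S \<subseteq> A \<and> card S = k} = card {S. S \<subseteq> A - T \<and> card S = k - card T}"
    by (rule bij_betw_same_card[symmetric])
  also have "\<dots> = (card A - card T) choose (k - card T)"
    using assms fin by (simp add: n_subsets card_Diff_subset)
  finally show ?thesis .
qed

text \<open>With denominators cleared, this is the inclusion probability \<open>b / n\<close> of an
  index in a uniform \<open>b\<close>-subset, where \<open>n = CARD('n)\<close>.\<close>

lemma card_subsets_containing1:
  assumes "1 \<le> b"
  shows "real CARD('n) * real (card {S. (i::'n::finite) \<in> S \<and> card S = b})
    = real (CARD('n) choose b) * real b"
proof -
  have "card {S. i \<in> S \<and> card S = b} = (CARD('n) - 1) choose (b - 1)"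
    using card_subsets_containing[of UNIV "{i}" b] assms by simp
  moreover have "b * (CARD('n) choose b) = CARD('n) * ((CARD('n) - 1) choose (b - 1))"
    using assms by (intro times_binomial_minus1_eq) auto
  ultimately show ?thesis
    by (metis mult.commute of_nat_mult)
qed

text \<open>These are the pair inclusion probabilities: \<open>b (b - 1) / (n (n - 1))\<close> off
  the diagonal and \<open>b / n\<close> on it. The diagonal value is written as the off-diagonal one
  plus an excess, since \<open>b (n - 1) = b (b - 1) + b (n - b)\<close>. In the second moment this
  separates the norm of the full sum from the sum of the individual norms.\<close>

lemma card_subsets_containing2:
  assumes b: "1 \<le> b" and n: "CARD('n) \<ge> 2"
  shows "real CARD('n) * (real CARD('n) - 1) * real (card {S. (i::'n::finite) \<in> S \<and> j \<in> S \<and> card S = b})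
    = real (CARD('n) choose b) * (real b * (real b - 1) + (if i = j then real b * (real CARD('n) - real b) else 0))"
proof (cases "i = j")
  case True
  then show ?thesis
    using card_subsets_containing1[OF b, of i] by (simp add: algebra_simps)
next
  case False
  let ?n = "CARD('n)"
  show ?thesis
  \<comment> \<open>For \<open>b = 1\<close> the truncated \<open>b - 2\<close> would be 0 and the
    binomial coefficient 1, although no singleton contains two distinct indices.\<close>
  proof (cases "b = 1")
    case True
    with False have "{S. i \<in> S \<and> j \<in> S \<and> card S = b} = {}"
      by (auto simp: card_1_singleton_iff)
    with True False show ?thesis by simp
  next
    assume "b \<noteq> 1"
    with b have b2: "b \<ge> 2" by simp
    let ?k = "card {S. i \<in> S \<and> j \<in> S \<and> card S = b}"
    have k: "?k = (?n - 2) choose (b - 2)"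
      using card_subsets_containing[of UNIV "{i, j}" b] b2 False by (simp add: numeral_2_eq_2)
    have "?n * (?n - 1) * ?k = ?n * ((?n - 1) * ?k)"
      by simp
    also have "(?n - 1) * ?k = (b - 1) * ((?n - 1) choose (b - 1))"
      unfolding k using b2 times_binomial_minus1_eq[of "b - 1" "?n - 1"] by (simp add: numeral_2_eq_2)
    also have "?n * \<dots> = (b - 1) * (?n * ((?n - 1) choose (b - 1)))"
      by (rule mult.left_commute)
    also have "?n * ((?n - 1) choose (b - 1)) = b * (?n choose b)"
      using b2 by (intro times_binomial_minus1_eq[symmetric]) auto
    finally have "real ?n * real (?n - 1) * real ?k = real (b - 1) * (real b * real (?n choose b))"
      by (simp only: of_nat_mult[symmetric] of_nat_eq_iff)
    with False b n show ?thesis by (simp add: of_nat_diff mult_ac)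
  qed
qed

text \<open>Double counting: after exchanging the sums, each \<open>u i\<close> occurs once for
  every \<open>b\<close>-subset containing \<open>i\<close>. This gives unbiasedness of the
  minibatch gradient.\<close>

lemma sum_over_subsets:
  fixes u :: "'n::finite \<Rightarrow> real"
  assumes "1 \<le> b"
  shows "real CARD('n) * (\<Sum>S | card S = b. \<Sum>i\<in>S. u i)
    = real (CARD('n) choose b) * real b * (\<Sum>i\<in>UNIV. u i)"
proof -
  have "(\<Sum>S | card S = b. \<Sum>i\<in>S. u i) = (\<Sum>i\<in>UNIV. \<Sum>S | i \<in> S \<and> card S = b. u i)"
    using sum.swap_restrict[of "{S. card S = b}" "UNIV::'n set" "\<lambda>S i. u i" "\<lambda>S i. i \<in> S"]
    by (simp add: conj_commute)
  then show ?thesis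
    using card_subsets_containing1[OF assms, where 'n = 'n]
    by (simp add: sum_distrib_left mult.assoc[symmetric])
qed

text \<open>The squared norm is a sum of inner products over the pairs in
  \<open>S \<times> S\<close>. Exchanging the sums weights each pair by the number of
  \<open>b\<close>-subsets containing both entries, and the diagonal excess of that count yields the
  second term.\<close>

lemma sum_over_subsets_norm_squared:
  fixes g :: "'n::finite \<Rightarrow> 'a::real_inner"
  assumes b: "1 \<le> b" and n: "CARD('n) \<ge> 2"
  shows "real CARD('n) * (real CARD('n) - 1) * (\<Sum>S | card S = b. (norm (\<Sum>i\<in>S. g i))\<^sup>2)
    = real (CARD('n) choose b) *
      (real b * (real b - 1) * (norm (\<Sum>i\<in>UNIV. g i))\<^sup>2
       + real b * (real CARD('n) - real b) * (\<Sum>i\<in>UNIV. (norm (g i))\<^sup>2))"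
    (is "?N * (_ - 1) * _ = ?C * (?p * _ + ?q * _)")
proof -
  define u where "u p = g (fst p) \<bullet> g (snd p)" for p
  have "(\<Sum>S | card S = b. (norm (\<Sum>i\<in>S. g i))\<^sup>2) = (\<Sum>S | card S = b. \<Sum>p\<in>S \<times> S. u p)"
    by (simp add: power2_norm_eq_inner inner_sum_left inner_sum_right sum.cartesian_product
        inner_commute u_def case_prod_unfold)
  also have "\<dots> = (\<Sum>S | card S = b. \<Sum>p | p \<in> UNIV \<and> p \<in> S \<times> S. u p)"
    by simp
  also have "\<dots> = (\<Sum>p\<in>UNIV. \<Sum>S | S \<in> {S. card S = b} \<and> p \<in> S \<times> S. u p)"
    by (rule sum.swap_restrict) auto
  also have "\<dots> = (\<Sum>p\<in>UNIV. real (card {S. fst p \<in> S \<and> snd p \<in> S \<and> card S = b}) * u p)"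
    by (simp add: mem_Times_iff conj_ac)
  finally have "?N * (?N - 1) * (\<Sum>S | card S = b. (norm (\<Sum>i\<in>S. g i))\<^sup>2)
      = (\<Sum>p\<in>UNIV. (?N * (?N - 1) * real (card {S. fst p \<in> S \<and> snd p \<in> S \<and> card S = b})) * u p)"
    by (simp add: sum_distrib_left mult.assoc)
  also have "\<dots> = (\<Sum>(i, j)\<in>UNIV. ?C * (?p * (g i \<bullet> g j) + (if i = j then ?q * (g i \<bullet> g j) else 0)))"
    unfolding card_subsets_containing2[OF b n] by (intro sum.cong) (auto simp: u_def algebra_simps)
  also have "\<dots> = (\<Sum>i\<in>UNIV. \<Sum>j\<in>UNIV. ?C * (?p * (g i \<bullet> g j) + (if i = j then ?q * (g i \<bullet> g j) else 0)))"
    by (simp add: sum.cartesian_product)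
  also have "\<dots> = ?C * (?p * (\<Sum>i\<in>UNIV. \<Sum>j\<in>UNIV. g i \<bullet> g j) + ?q * (\<Sum>i\<in>UNIV. g i \<bullet> g i))"
    by (simp add: sum.distrib flip: sum_distrib_left)
  also have "\<dots> = ?C * (?p * (norm (\<Sum>i\<in>UNIV. g i))\<^sup>2 + ?q * (\<Sum>i\<in>UNIV. (norm (g i))\<^sup>2))"
    by (simp add: power2_norm_eq_inner inner_sum_left inner_sum_right inner_commute)
  finally show ?thesis .
qed

section \<open>One step of minibatch SGD\<close>

text \<open>The atoms of the law prescribed by \<open>minibatch_sampling\<close>.\<close>

definition minibatch_weights :: "nat \<Rightarrow> 'n::finite set \<Rightarrow> real^'n" where
  "minibatch_weights b S = (real CARD('n) / real b) *\<^sub>R (\<Sum>i\<in>S. axis i 1)"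

lemma minibatch_weights_nth:
  "minibatch_weights b S $ i = (if i \<in> S then real CARD('n) / real b else 0)" for i :: "'n::finite"
proof -
  have "(\<Sum>j\<in>S. axis j (1::real) $ i) = (if i \<in> S then 1 else 0)"
    by (simp add: axis_def)
  then show ?thesis
    by (simp add: minibatch_weights_def)
qed

text \<open>For \<open>b \<ge> 1\<close> the nonzero entries are exactly those indexed by
  \<open>S\<close>. Hence different subsets give disjoint events, which is how the law of the
  sampling is recovered below.\<close>

lemma minibatch_weights_inject:
  fixes S T :: "'n::finite set"
  assumes "1 \<le> b"
  shows "minibatch_weights b S = minibatch_weights b T \<longleftrightarrow> S = T"
proof
  assume "minibatch_weights b S = minibatch_weights b T"
  then have "minibatch_weights b S $ i = minibatch_weights b T $ i" for i
    by simp
  then have "i \<in> S \<longleftrightarrow> i \<in> T" for i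
    using assms by (metis minibatch_weights_nth divide_eq_0_iff of_nat_eq_0_iff not_one_le_zero
        card_eq_0_iff UNIV_not_empty finite)
  then show "S = T" by blast
qed simp

lemma grad_weighted_average_minibatch:
  assumes diff: "\<And>i. f i differentiable (at x)"
  shows "grad (weighted_average f (minibatch_weights b S)) x
    = (1 / real b) *\<^sub>R (\<Sum>i\<in>S. grad (f (i::'n::finite)) x)"
proof -
  have "(\<Sum>i\<in>UNIV. minibatch_weights b S $ i *\<^sub>R grad (f i) x)
      = (\<Sum>i\<in>UNIV. if i \<in> S then (real CARD('n) / real b) *\<^sub>R grad (f i) x else 0)"
    by (intro sum.cong) (auto simp: minibatch_weights_nth)
  also have "\<dots> = (real CARD('n) / real b) *\<^sub>R (\<Sum>i\<in>S. grad (f i) x)"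
    by (simp add: scaleR_right.sum sum.If_cases)
  finally show ?thesis
    by (simp add: grad_weighted_average[OF diff])
qed

lemma interpolation_average_le:
  "interpolation f xs \<Longrightarrow> average f xs \<le> average f y"
  unfolding average_def interpolation_def minimizers_def
  by (auto intro!: divide_right_mono sum_mono)

text \<open>The exact second moment yields the smaller constant
  \<open>(Lmax (n - b) + L n (b - 1)) / ((n - 1) b)\<close>; the one below is the one in the step size.\<close>

definition expected_smoothness :: "nat \<Rightarrow> nat \<Rightarrow> real \<Rightarrow> real \<Rightarrow> real" where
  "expected_smoothness n b L Lmax =
     (2 * Lmax * (real n - real b) + L * (real n - 1) * real b) / ((real n - 1) * real b)"

text \<open>The exact second moment combines the squared norm of the full gradient sum, bounded
  through the smoothness of the average, and the sum of the squared norms of the individual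
  gradients, bounded through the smoothness of each \<open>f i\<close>. Interpolation makes
  \<open>xs\<close> a minimizer in both bounds, so no noise term remains at the solution.\<close>

lemma second_moment_minibatch_grad:
  fixes f :: "'n::finite \<Rightarrow> 'a::euclidean_space \<Rightarrow> real"
  assumes n: "CARD('n) \<ge> 2" and b: "1 \<le> b" "b \<le> CARD('n)"
    and diff: "\<And>i. f i differentiable (at x)"
    and smooth: "smooth_with L (average f)"
    and smooth_i: "\<And>i. smooth_with (Li i) (f i)" "\<And>i. Li i \<le> Lmax"
    and interp: "interpolation f xs"
  shows "(\<Sum>S | card S = b. (norm ((1 / real b) *\<^sub>R (\<Sum>i\<in>S. grad (f i) x)))\<^sup>2)
    \<le> real (CARD('n) choose b) * (2 * expected_smoothness CARD('n) b L Lmax * (average f x - average f xs))"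
proof -
  let ?n = "real CARD('n)" and ?b = "real b" and ?C = "real (CARD('n) choose b)"
  let ?gap = "average f x - average f xs"
  define A where "A = (\<Sum>S | card S = b. (norm (\<Sum>i\<in>S. grad (f i) x))\<^sup>2)"
  define G where "G = (norm (\<Sum>i\<in>UNIV. grad (f i) x))\<^sup>2"
  define H where "H = (\<Sum>i\<in>UNIV. (norm (grad (f i) x))\<^sup>2)"
  have nb: "?n \<ge> 2" "?b \<ge> 1" "?b \<le> ?n" using n b by auto
  have le: "f i xs \<le> f i y" for i y
    using interp by (simp add: interpolation_def minimizers_def)
  note av_le = interpolation_average_le[OF interp]
  have gap: "?gap \<ge> 0" using av_le[of x] by simp
  have L: "L > 0" using smooth by (simp add: smooth_with_def)
  \<comment> \<open>\<open>undefined\<close> serves as an arbitrary index: a single positive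
    \<open>Li i\<close> below \<open>Lmax\<close> suffices.\<close>
  have Lmax: "Lmax > 0" using smooth_i[of undefined] by (auto simp: smooth_with_def)
  have "(norm (grad (average f) x))\<^sup>2 \<le> 2 * L * ?gap"
    using smooth av_le by (rule smooth_with_grad_le)
  then have G: "G \<le> ?n\<^sup>2 * (2 * L * ?gap)"
    using nb by (simp add: grad_average[OF diff] G_def power_divide pos_divide_le_eq mult.commute)
  have "H \<le> (\<Sum>i\<in>UNIV. 2 * Lmax * (f i x - f i xs))"
    unfolding H_def
  proof (rule sum_mono)
    fix i
    have "(norm (grad (f i) x))\<^sup>2 \<le> 2 * Li i * (f i x - f i xs)"
      using smooth_i(1) le by (rule smooth_with_grad_le)
    also have "\<dots> \<le> 2 * Lmax * (f i x - f i xs)"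
      using smooth_i(2)[of i] le[of i x] by (intro mult_right_mono) auto
    finally show "(norm (grad (f i) x))\<^sup>2 \<le> 2 * Lmax * (f i x - f i xs)" .
  qed
  also have "\<dots> = ?n * (2 * Lmax * ?gap)"
    by (simp add: average_def sum_subtractf sum_distrib_left[symmetric] right_diff_distrib[symmetric]
        diff_divide_distrib[symmetric])
  finally have H: "H \<le> ?n * (2 * Lmax * ?gap)" .
  have "?n * (?n - 1) * A = ?C * (?b * (?b - 1) * G + ?b * (?n - ?b) * H)"
    unfolding A_def G_def H_def by (rule sum_over_subsets_norm_squared[OF b(1) n])
  also have "\<dots> \<le> ?C * (?b * (?b - 1) * (?n\<^sup>2 * (2 * L * ?gap)) + ?b * (?n - ?b) * (?n * (2 * Lmax * ?gap)))"
    using G H nb by (intro mult_left_mono add_mono) auto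
  also have "\<dots> = ?n * ?C * (2 * ?b * ((?b - 1) * ?n * L + (?n - ?b) * Lmax) * ?gap)"
    by (simp add: algebra_simps power2_eq_square)
  \<comment> \<open>Here the exact constant is relaxed to the one in the step size:
    \<open>Lmax\<close> is doubled, and \<open>(b - 1) n\<close> is replaced by
    \<open>(n - 1) b\<close>, which is larger by \<open>n - b\<close>.\<close>
  also have "\<dots> \<le> ?n * ?C * (2 * ?b * ((?n - 1) * ?b * L + (?n - ?b) * (2 * Lmax)) * ?gap)"
  proof (intro mult_left_mono mult_right_mono add_mono)
    show "(?b - 1) * ?n \<le> (?n - 1) * ?b" using nb by (simp add: algebra_simps)
  qed (use nb L Lmax gap in auto)
  finally have "(?n - 1) * A \<le> ?C * (2 * ?b * ((?n - 1) * ?b * L + (?n - ?b) * (2 * Lmax)) * ?gap)"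
    using nb by (simp add: mult.assoc)
  then have "A \<le> ?C * (2 * ?b * ((?n - 1) * ?b * L + (?n - ?b) * (2 * Lmax)) * ?gap) / (?n - 1)"
    using nb by (simp add: pos_le_divide_eq mult.commute)
  also have "\<dots> = ?b\<^sup>2 * (?C * (2 * expected_smoothness CARD('n) b L Lmax * ?gap))"
    using nb by (simp add: expected_smoothness_def divide_simps) (simp add: algebra_simps power2_eq_square)
  finally have "A / ?b\<^sup>2 \<le> ?C * (2 * expected_smoothness CARD('n) b L Lmax * ?gap)"
    using nb by (simp add: pos_divide_le_eq mult.commute)
  then show ?thesis
    by (simp add: A_def power_divide sum_divide_distrib)
qed

text \<open>Expand the square. The cross term averages to the full gradient, so quasar-convexity
  makes it at most \<open>- 2 \<gamma> \<zeta>\<close> times the gap. For this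
  \<open>\<gamma>\<close> the second moment term is at most \<open>\<gamma> \<zeta>\<close> times
  the gap, which uses up half of the decrease.\<close>

lemma minibatch_step_descent:
  fixes f :: "'n::finite \<Rightarrow> 'a::euclidean_space \<Rightarrow> real"
  assumes n: "CARD('n) \<ge> 2" and b: "1 \<le> b" "b \<le> CARD('n)"
    and diff: "\<And>i. f i differentiable (at x)"
    and smooth: "smooth_with L (average f)"
    and smooth_i: "\<And>i. smooth_with (Li i) (f i)" "\<And>i. Li i \<le> Lmax"
    and quasar: "quasar_convex \<zeta> (average f) xs"
    and interp: "interpolation f xs"
    and step: "\<gamma> = \<zeta> / (2 * expected_smoothness CARD('n) b L Lmax)"
  shows "(\<Sum>S | card S = b.
      (norm (x - \<gamma> *\<^sub>R grad (weighted_average f (minibatch_weights b S)) x - xs))\<^sup>2)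
    \<le> real (CARD('n) choose b) * ((norm (x - xs))\<^sup>2 - \<gamma> * \<zeta> * (average f x - average f xs))"
proof -
  let ?C = "real (CARD('n) choose b)" and ?L = "expected_smoothness CARD('n) b L Lmax"
  let ?gap = "average f x - average f xs"
  define d where "d S = (1 / real b) *\<^sub>R (\<Sum>i\<in>S. grad (f i) x)" for S
  have nb: "real CARD('n) \<ge> 2" "real b \<ge> 1" "real b \<le> real CARD('n)" using n b by auto
  have L: "L > 0" using smooth by (simp add: smooth_with_def)
  have Lmax: "Lmax > 0" using smooth_i[of undefined] by (auto simp: smooth_with_def)
  have Lpos: "?L > 0"
    unfolding expected_smoothness_def
    using nb L Lmax by (intro divide_pos_pos add_nonneg_pos) auto
  have \<zeta>: "\<zeta> > 0" "average f xs \<ge> average f x + 1 / \<zeta> * (grad (average f) x \<bullet> (xs - x))"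
    using quasar by (auto simp: quasar_convex_def)
  have \<gamma>: "\<gamma> > 0" using Lpos \<zeta> step by simp
  have qc: "\<zeta> * ?gap \<le> grad (average f) x \<bullet> (x - xs)"
  proof -
    have "?gap \<le> (grad (average f) x \<bullet> (x - xs)) / \<zeta>"
      using \<zeta>(2) by (simp add: inner_diff_right diff_divide_distrib)
    then show ?thesis using \<zeta>(1) by (simp add: pos_le_divide_eq mult.commute)
  qed
  have "real CARD('n) * (\<Sum>S | card S = b. \<Sum>i\<in>S. grad (f i) x \<bullet> (x - xs))
      = ?C * real b * (\<Sum>i\<in>UNIV. grad (f i) x \<bullet> (x - xs))"
    by (rule sum_over_subsets[OF b(1)])
  then have mean: "(\<Sum>S | card S = b. d S \<bullet> (x - xs)) = ?C * (grad (average f) x \<bullet> (x - xs))"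
    using nb by (simp add: d_def grad_average[OF diff] inner_sum_left sum_divide_distrib[symmetric] field_simps)
  have second: "(\<Sum>S | card S = b. (norm (d S))\<^sup>2) \<le> ?C * (2 * ?L * ?gap)"
    unfolding d_def by (rule second_moment_minibatch_grad[OF n b diff smooth smooth_i interp])
  have card: "real (card {S::'n set. card S = b}) = ?C"
    using n_subsets[of "UNIV::'n set" b] by simp
  have "(norm (x - \<gamma> *\<^sub>R d S - xs))\<^sup>2
      = (norm (x - xs))\<^sup>2 - 2 * \<gamma> * (d S \<bullet> (x - xs)) + \<gamma>\<^sup>2 * (norm (d S))\<^sup>2" for S
    unfolding power2_norm_eq_inner by (simp add: inner_diff inner_commute algebra_simps power2_eq_square)
  then have "(\<Sum>S | card S = b. (norm (x - \<gamma> *\<^sub>R d S - xs))\<^sup>2)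
      = ?C * (norm (x - xs))\<^sup>2 - 2 * \<gamma> * (\<Sum>S | card S = b. d S \<bullet> (x - xs))
        + \<gamma>\<^sup>2 * (\<Sum>S | card S = b. (norm (d S))\<^sup>2)"
    by (simp add: sum.distrib sum_subtractf sum_distrib_left card)
  also have "\<dots> \<le> ?C * (norm (x - xs))\<^sup>2 - 2 * \<gamma> * (?C * (\<zeta> * ?gap)) + \<gamma>\<^sup>2 * (?C * (2 * ?L * ?gap))"
    unfolding mean using second qc \<gamma> by (intro add_mono diff_left_mono mult_left_mono) auto
  also have "\<gamma>\<^sup>2 * (?C * (2 * ?L * ?gap)) = \<gamma> * (?C * (2 * ?L * \<gamma> * ?gap))"
    by (simp only: power2_eq_square ac_simps)
  also have "2 * ?L * \<gamma> = \<zeta>"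
    using step Lpos by simp
  finally show ?thesis
    by (simp add: grad_weighted_average_minibatch[OF diff] d_def algebra_simps)
qed

section \<open>Expectations\<close>

text \<open>Independence makes the joint law a product, and Tonelli splits the integral. This plays
  the part of conditioning on \<open>X\<close>; nonnegative integrals spare any integrability
  argument for the iterates.\<close>

lemma (in prob_space) nn_integral_indep_var:
  assumes ind: "indep_var S X T Y" and h[measurable]: "h \<in> borel_measurable (S \<Otimes>\<^sub>M T)"
  shows "(\<integral>\<^sup>+w. h (X w, Y w) \<partial>M) = (\<integral>\<^sup>+w. (\<integral>\<^sup>+w'. h (X w, Y w') \<partial>M) \<partial>M)"
proof -
  have [measurable]: "X \<in> measurable M S" "Y \<in> measurable M T"
    using ind by (auto dest: indep_var_rv1 indep_var_rv2)
  interpret Y: prob_space "distr M T Y" by (rule prob_space_distr) simp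
  have "(\<integral>\<^sup>+w. h (X w, Y w) \<partial>M) = (\<integral>\<^sup>+p. h p \<partial>distr M (S \<Otimes>\<^sub>M T) (\<lambda>w. (X w, Y w)))"
    by (simp add: nn_integral_distr)
  also have "distr M (S \<Otimes>\<^sub>M T) (\<lambda>w. (X w, Y w)) = distr M S X \<Otimes>\<^sub>M distr M T Y"
    using ind unfolding indep_var_distribution_eq by simp
  also have "(\<integral>\<^sup>+p. h p \<partial>(distr M S X \<Otimes>\<^sub>M distr M T Y)) = (\<integral>\<^sup>+x. (\<integral>\<^sup>+y. h (x, y) \<partial>distr M T Y) \<partial>distr M S X)"
    by (rule Y.nn_integral_fst[symmetric]) (simp cong: measurable_cong_sets)
  also have "\<dots> = (\<integral>\<^sup>+w. (\<integral>\<^sup>+y. h (X w, y) \<partial>distr M T Y) \<partial>M)"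
    by (rule nn_integral_distr) measurable
  also have "\<dots> = (\<integral>\<^sup>+w. (\<integral>\<^sup>+w'. h (X w, Y w') \<partial>M) \<partial>M)"
    by (intro nn_integral_cong nn_integral_distr measurable_compose_Pair1[OF _ h])
      (auto dest: measurable_space[OF \<open>X \<in> measurable M S\<close>])
  finally show ?thesis .
qed

text \<open>The sampling is specified only by the probabilities of its atoms. There are
  \<open>CARD('n) choose b\<close> disjoint atoms of equal mass with total mass 1, so
  \<open>v\<close> almost surely takes one of these values and the integral is their plain
  average.\<close>

lemma nn_integral_minibatch_sampling:
  fixes v :: "'u \<Rightarrow> real^'n::finite"
  assumes samp: "minibatch_sampling N b v" and b: "1 \<le> b" "b \<le> CARD('n)"
    and h[measurable]: "h \<in> borel_measurable borel"
  shows "(\<integral>\<^sup>+w. h (v w) \<partial>N)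
    = (\<Sum>S | card S = b. h (minibatch_weights b S)) * ennreal (1 / real (CARD('n) choose b))"
proof -
  let ?p = "1 / real (CARD('n) choose b)" and ?Sb = "{S::'n set. card S = b}"
  define E where "E S = {w \<in> space N. v w = minibatch_weights b S}" for S
  interpret prob_space N using samp by (simp add: minibatch_sampling_def)
  have [measurable]: "v \<in> borel_measurable N" using samp by (simp add: minibatch_sampling_def)
  have E[measurable]: "E S \<in> sets N" for S unfolding E_def by measurable
  have prob: "prob (E S) = ?p" if "S \<in> ?Sb" for S
    using samp that by (simp add: minibatch_sampling_def E_def minibatch_weights_def)
  have disj: "disjoint_family_on E ?Sb"
    using b by (auto simp: disjoint_family_on_def E_def minibatch_weights_inject)
  have "prob (\<Union>S\<in>?Sb. E S) = (\<Sum>S\<in>?Sb. prob (E S))"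
    using disj by (intro finite_measure_finite_Union) auto
  also have "\<dots> = 1"
    using prob n_subsets[of "UNIV::'n set" b] b by simp
  finally have "AE w in N. w \<in> (\<Union>S\<in>?Sb. E S)"
    by (subst AE_in_set_eq_1) auto
  then have "AE w in N. h (v w) = (\<Sum>S\<in>?Sb. h (minibatch_weights b S) * indicator (E S) w)"
  proof (rule AE_mp, intro AE_I2 impI)
    fix w assume "w \<in> (\<Union>S\<in>?Sb. E S)"
    then obtain S where S: "S \<in> ?Sb" "w \<in> E S" by blast
    then have "w \<in> E T \<longleftrightarrow> T = S" if "T \<in> ?Sb" for T
      using disj that by (auto simp: disjoint_family_on_def)
    then have "(\<Sum>T\<in>?Sb. h (minibatch_weights b T) * indicator (E T) w)
        = (\<Sum>T\<in>?Sb. if T = S then h (minibatch_weights b T) else 0)"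
      by (intro sum.cong) (auto simp: indicator_def)
    then show "h (v w) = (\<Sum>S\<in>?Sb. h (minibatch_weights b S) * indicator (E S) w)"
      using S by (simp add: E_def)
  qed
  then have "(\<integral>\<^sup>+w. h (v w) \<partial>N) = (\<integral>\<^sup>+w. (\<Sum>S\<in>?Sb. h (minibatch_weights b S) * indicator (E S) w) \<partial>N)"
    by (rule nn_integral_cong_AE)
  also have "\<dots> = (\<Sum>S\<in>?Sb. h (minibatch_weights b S) * emeasure N (E S))"
    by (subst nn_integral_sum) (auto simp: nn_integral_cmult_indicator)
  also have "\<dots> = (\<Sum>S\<in>?Sb. h (minibatch_weights b S)) * ennreal ?p"
    using prob by (simp add: emeasure_eq_measure sum_distrib_right)
  finally show ?thesis .
qed

section \<open>Measurability of the iterates and their independence of the next sample\<close>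

lemma borel_measurable_vec_nth [measurable]: "(\<lambda>v::real^'n. v $ i) \<in> borel_measurable borel"
  by (intro borel_measurable_continuous_onI continuous_intros)

lemma sgd_cong:
  "(\<And>j. j < k \<Longrightarrow> vs j = ws j) \<Longrightarrow> sgd f \<gamma> x0 vs k = sgd f \<gamma> x0 ws k"
  by (induction k) auto

lemma borel_measurable_grad_weighted_average:
  fixes f :: "'n::finite \<Rightarrow> 'a::euclidean_space \<Rightarrow> real"
  assumes diff: "\<And>i x. f i differentiable (at x)"
    and [measurable]: "V \<in> borel_measurable M" "Y \<in> borel_measurable M"
  shows "(\<lambda>w. grad (weighted_average f (V w)) (Y w)) \<in> borel_measurable M"
proof -
  have [measurable]: "grad (f i) \<in> borel_measurable borel" for i
    by (rule borel_measurable_grad[OF diff])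
  show ?thesis
    unfolding grad_weighted_average[OF diff] by measurable
qed

lemma borel_measurable_average:
  fixes f :: "'n::finite \<Rightarrow> 'a::euclidean_space \<Rightarrow> real"
  assumes diff: "\<And>i x. f i differentiable (at x)"
  shows "average f \<in> borel_measurable borel"
proof -
  have [measurable]: "f i \<in> borel_measurable borel" for i
    using diff by (intro borel_measurable_continuous_onI)
      (simp add: continuous_at_imp_continuous_on differentiable_imp_continuous_within)
  then show "average f \<in> borel_measurable borel"
    unfolding average_def[abs_def] by measurable
qed

text \<open>Only the weights used before step \<open>k\<close> have to be measurable. Thus the lemma
  also applies to the coordinates of the product space over \<open>{..<t}\<close>, as the
  independence argument needs.\<close>

lemma borel_measurable_sgd:
  fixes f :: "'n::finite \<Rightarrow> 'a::euclidean_space \<Rightarrow> real"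
  assumes diff: "\<And>i x. f i differentiable (at x)"
    and V: "\<And>j. j < k \<Longrightarrow> (\<lambda>w. V w j) \<in> borel_measurable M"
  shows "(\<lambda>w. sgd f \<gamma> x0 (V w) k) \<in> borel_measurable M"
  using V
proof (induction k)
  case (Suc k)
  have [measurable]: "(\<lambda>w. sgd f \<gamma> x0 (V w) k) \<in> borel_measurable M"
    using Suc by auto
  have [measurable]: "(\<lambda>w. grad (weighted_average f (V w k)) (sgd f \<gamma> x0 (V w) k)) \<in> borel_measurable M"
    using Suc.prems by (intro borel_measurable_grad_weighted_average diff) auto
  show ?case by simp
qed simp

text \<open>The iterate is a function of the samples indexed by \<open>{..<t}\<close>, the fresh
  weight one of the block \<open>{t}\<close>. Disjoint blocks of an independent family are
  independent, and \<open>sgd_cong\<close> allows the restricted family in place of the full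
  one.\<close>

lemma (in prob_space) nn_integral_sgd_indep:
  fixes f :: "'n::finite \<Rightarrow> 'b::euclidean_space \<Rightarrow> real"
  assumes diff: "\<And>i x. f i differentiable (at x)"
    and ind: "indep_vars (\<lambda>_. borel) V UNIV"
    and h[measurable]: "h \<in> borel_measurable (borel \<Otimes>\<^sub>M borel)"
  shows "(\<integral>\<^sup>+w. h (sgd f \<gamma> x0 (\<lambda>j. V j w) t, V t w) \<partial>M)
    = (\<integral>\<^sup>+w. (\<integral>\<^sup>+w'. h (sgd f \<gamma> x0 (\<lambda>j. V j w) t, V t w') \<partial>M) \<partial>M)"
proof -
  have [measurable]: "(\<lambda>u. sgd f \<gamma> x0 u t) \<in> borel_measurable (PiM {..<t} (\<lambda>_. borel))"
    by (intro borel_measurable_sgd diff measurable_component_singleton) auto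
  have V: "indep_var (PiM {..<t} (\<lambda>_. borel)) (\<lambda>w. restrict (\<lambda>j. V j w) {..<t})
      (PiM {t} (\<lambda>_. borel)) (\<lambda>w. restrict (\<lambda>j. V j w) {t})"
    by (rule indep_var_restrict[OF ind]) auto
  have "(\<lambda>(u, u'). h (sgd f \<gamma> x0 u t, u' t))
      \<in> borel_measurable (PiM {..<t} (\<lambda>_. borel) \<Otimes>\<^sub>M PiM {t} (\<lambda>_. borel))"
    by measurable
  from nn_integral_indep_var[OF V this]
  have "(\<integral>\<^sup>+w. h (sgd f \<gamma> x0 (restrict (\<lambda>j. V j w) {..<t}) t, V t w) \<partial>M)
    = (\<integral>\<^sup>+w. (\<integral>\<^sup>+w'. h (sgd f \<gamma> x0 (restrict (\<lambda>j. V j w) {..<t}) t, V t w') \<partial>M) \<partial>M)"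
    by simp
  moreover have "sgd f \<gamma> x0 (restrict (\<lambda>j. V j w) {..<t}) t = sgd f \<gamma> x0 (\<lambda>j. V j w) t" for w
    by (rule sgd_cong) simp
  ultimately show ?thesis by simp
qed

section \<open>Descent in expectation and the convergence rate\<close>

text \<open>Average the one-step inequality over the fresh sample with the iterate held fixed, then
  over the iterate. The gap stands on the left as a summand because subtraction of extended
  nonnegative reals is truncated.\<close>

lemma sgd_expected_descent:
  fixes f :: "'n::finite \<Rightarrow> 'a::euclidean_space \<Rightarrow> real" and \<gamma> :: "nat \<Rightarrow> real" and x0 :: 'a
    and V :: "nat \<Rightarrow> 'w \<Rightarrow> real^'n" and v :: "'u \<Rightarrow> real^'n"
  defines "X \<equiv> \<lambda>t w. sgd f \<gamma> x0 (\<lambda>j. V j w) t"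
  assumes n: "CARD('n) \<ge> 2" and b: "1 \<le> b" "b \<le> CARD('n)"
    and diff: "\<And>i x. f i differentiable (at x)"
    and smooth: "smooth_with L (average f)"
    and smooth_i: "\<And>i. smooth_with (Li i) (f i)" "\<And>i. Li i \<le> Lmax"
    and quasar: "quasar_convex \<zeta> (average f) xs"
    and interp: "interpolation f xs"
    and step: "\<gamma> t = \<zeta> / (2 * expected_smoothness CARD('n) b L Lmax)" "\<gamma> t > 0"
    and sampling: "minibatch_sampling N b v"
    and iid: "iid_copies M V N v"
  shows "(\<integral>\<^sup>+w. ennreal ((norm (X (Suc t) w - xs))\<^sup>2) \<partial>M)
      + ennreal (\<gamma> t * \<zeta>) * (\<integral>\<^sup>+w. ennreal (average f (X t w) - average f xs) \<partial>M)
    \<le> (\<integral>\<^sup>+w. ennreal ((norm (X t w - xs))\<^sup>2) \<partial>M)"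
proof -
  let ?p = "1 / real (CARD('n) choose b)"
  let ?gap = "\<lambda>y. average f y - average f xs"
  define h where "h = (\<lambda>(y, u). ennreal ((norm (y - \<gamma> t *\<^sub>R grad (weighted_average f u) y - xs))\<^sup>2))"
  interpret prob_space M using iid by (simp add: iid_copies_def)
  have v[measurable]: "v \<in> borel_measurable N" using sampling by (simp add: minibatch_sampling_def)
  have Vm[measurable]: "V j \<in> borel_measurable M" for j
    using iid by (auto simp: iid_copies_def indep_vars_def)
  have Xm[measurable]: "X k \<in> borel_measurable M" for k
    unfolding X_def by (intro borel_measurable_sgd diff Vm)
  have [measurable]: "average f \<in> borel_measurable borel"
    by (rule borel_measurable_average[OF diff])
  have [measurable]: "(\<lambda>p. grad (weighted_average f (snd p)) (fst p))
      \<in> borel_measurable (borel \<Otimes>\<^sub>M borel)"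
    by (intro borel_measurable_grad_weighted_average diff) auto
  have h[measurable]: "h \<in> borel_measurable (borel \<Otimes>\<^sub>M borel)"
    unfolding h_def case_prod_unfold by measurable
  have gap: "?gap y \<ge> 0" for y
    using interpolation_average_le[OF interp, of y] by simp
  have \<zeta>: "\<zeta> > 0" using quasar by (simp add: quasar_convex_def)
  have C: "real (CARD('n) choose b) > 0" using b by simp
  \<comment> \<open>The iterate is frozen at \<open>y\<close>; since \<open>V t\<close> has the law
    of \<open>v\<close>, the integral is an average over the \<open>b\<close>-subsets.\<close>
  have inner: "(\<integral>\<^sup>+w'. h (y, V t w') \<partial>M) + ennreal (\<gamma> t * \<zeta> * ?gap y)
      \<le> ennreal ((norm (y - xs))\<^sup>2)" for y
  proof -
    let ?A = "\<Sum>S | card S = b. (norm (y - \<gamma> t *\<^sub>R grad (weighted_average f (minibatch_weights b S)) y - xs))\<^sup>2"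
    have "(\<integral>\<^sup>+w'. h (y, V t w') \<partial>M) = (\<integral>\<^sup>+u. h (y, u) \<partial>distr M borel (V t))"
      by (rule nn_integral_distr[symmetric]) measurable
    also have "\<dots> = (\<integral>\<^sup>+u. h (y, u) \<partial>distr N borel v)"
      using iid by (simp add: iid_copies_def)
    also have "\<dots> = (\<integral>\<^sup>+w. h (y, v w) \<partial>N)"
      by (rule nn_integral_distr) measurable
    also have "\<dots> = (\<Sum>S | card S = b. h (y, minibatch_weights b S)) * ennreal ?p"
      by (rule nn_integral_minibatch_sampling[OF sampling b]) measurable
    also have "\<dots> = ennreal ?A * ennreal ?p"
      by (simp add: h_def sum_ennreal)
    also have "\<dots> = ennreal (?A * ?p)"
      by (rule ennreal_mult[symmetric]) (auto intro: sum_nonneg)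
    finally have "(\<integral>\<^sup>+w'. h (y, V t w') \<partial>M) + ennreal (\<gamma> t * \<zeta> * ?gap y)
        = ennreal (?A * ?p + \<gamma> t * \<zeta> * ?gap y)"
      using gap[of y] \<zeta> step(2) by (simp add: sum_nonneg ennreal_plus)
    also have "\<dots> \<le> ennreal ((norm (y - xs))\<^sup>2)"
    proof (rule ennreal_leI)
      have "?A \<le> real (CARD('n) choose b) * ((norm (y - xs))\<^sup>2 - \<gamma> t * \<zeta> * ?gap y)"
        using minibatch_step_descent[OF n b diff smooth smooth_i quasar interp step(1)] .
      then have "?A * ?p \<le> (norm (y - xs))\<^sup>2 - \<gamma> t * \<zeta> * ?gap y"
        using C by (simp add: pos_divide_le_eq mult.commute)
      then show "?A * ?p + \<gamma> t * \<zeta> * ?gap y \<le> (norm (y - xs))\<^sup>2" by simp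
    qed
    finally show ?thesis .
  qed
  have "(\<integral>\<^sup>+w. h (X t w, V t w) \<partial>M) = (\<integral>\<^sup>+w. (\<integral>\<^sup>+w'. h (X t w, V t w') \<partial>M) \<partial>M)"
    unfolding X_def using iid by (intro nn_integral_sgd_indep diff h) (auto simp: iid_copies_def)
  moreover have "h (X t w, V t w) = ennreal ((norm (X (Suc t) w - xs))\<^sup>2)" for w
    by (simp add: h_def X_def)
  ultimately have "(\<integral>\<^sup>+w. ennreal ((norm (X (Suc t) w - xs))\<^sup>2) \<partial>M)
      = (\<integral>\<^sup>+w. (\<integral>\<^sup>+w'. h (X t w, V t w') \<partial>M) \<partial>M)"
    by simp
  moreover have "ennreal (\<gamma> t * \<zeta>) * (\<integral>\<^sup>+w. ennreal (?gap (X t w)) \<partial>M)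
      = (\<integral>\<^sup>+w. ennreal (\<gamma> t * \<zeta> * ?gap (X t w)) \<partial>M)"
    using gap \<zeta> step(2) by (simp add: nn_integral_cmult[symmetric] ennreal_mult)
  moreover have "(\<integral>\<^sup>+w. (\<integral>\<^sup>+w'. h (X t w, V t w') \<partial>M) \<partial>M)
        + (\<integral>\<^sup>+w. ennreal (\<gamma> t * \<zeta> * ?gap (X t w)) \<partial>M)
      = (\<integral>\<^sup>+w. (\<integral>\<^sup>+w'. h (X t w, V t w') \<partial>M) + ennreal (\<gamma> t * \<zeta> * ?gap (X t w)) \<partial>M)"
  proof (rule nn_integral_add[symmetric])
    show "(\<lambda>w. \<integral>\<^sup>+w'. h (X t w, V t w') \<partial>M) \<in> borel_measurable M"
      by measurable
  qed measurable
  moreover have "\<dots> \<le> (\<integral>\<^sup>+w. ennreal ((norm (X t w - xs))\<^sup>2) \<partial>M)"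
    by (intro nn_integral_mono inner)
  ultimately show ?thesis by simp
qed

text \<open>Telescoping bounds the sum of the \<open>k\<close> expected gaps, each times
  \<open>c\<close>, by the initial squared distance. The minimum is at most each of them, so
  \<open>k * c\<close> times the minimum obeys the same bound.\<close>

lemma sgd_min_expected_gap:
  fixes f :: "'n::finite \<Rightarrow> 'a::euclidean_space \<Rightarrow> real" and \<gamma> :: "nat \<Rightarrow> real" and x0 :: 'a
    and V :: "nat \<Rightarrow> 'w \<Rightarrow> real^'n" and v :: "'u \<Rightarrow> real^'n"
  assumes n: "CARD('n) \<ge> 2" and b: "1 \<le> b" "b \<le> CARD('n)"
    and diff: "\<And>i x. f i differentiable (at x)"
    and smooth: "smooth_with L (average f)"
    and smooth_i: "\<And>i. smooth_with (Li i) (f i)" "\<And>i. Li i \<le> Lmax"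
    and quasar: "quasar_convex \<zeta> (average f) xs"
    and interp: "interpolation f xs"
    and step: "\<And>t. \<gamma> t = \<zeta> / (2 * expected_smoothness CARD('n) b L Lmax)"
    and sampling: "minibatch_sampling N b v"
    and iid: "iid_copies M V N v"
    and k: "k \<ge> 1"
  shows "(MIN t\<in>{0..<k}. expected_gap M f xs (\<lambda>t w. sgd f \<gamma> x0 (\<lambda>j. V j w) t) t)
    \<le> expected_smoothness CARD('n) b L Lmax / \<zeta>\<^sup>2 * (2 * (norm (x0 - xs))\<^sup>2 / real k)"
proof -
  define X where "X = (\<lambda>t w. sgd f \<gamma> x0 (\<lambda>j. V j w) t)"
  let ?L = "expected_smoothness CARD('n) b L Lmax"
  \<comment> \<open>This is the product \<open>\<gamma> t * \<zeta>\<close>, the guaranteed decrease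
    per unit of gap.\<close>
  define c where "c = \<zeta>\<^sup>2 / (2 * ?L)"
  define U where "U t = (\<integral>\<^sup>+w. ennreal ((norm (X t w - xs))\<^sup>2) \<partial>M)" for t
  define G where "G t = (\<integral>\<^sup>+w. ennreal (average f (X t w) - average f xs) \<partial>M)" for t
  define m where "m = (MIN t\<in>{0..<k}. expected_gap M f xs X t)"
  interpret prob_space M using iid by (simp add: iid_copies_def)
  have L: "L > 0" using smooth by (simp add: smooth_with_def)
  have Lmax: "Lmax > 0" using smooth_i[of undefined] by (auto simp: smooth_with_def)
  have \<zeta>: "\<zeta> > 0" using quasar by (simp add: quasar_convex_def)
  have Lpos: "?L > 0"
    unfolding expected_smoothness_def
    using n b L Lmax by (intro divide_pos_pos add_nonneg_pos) auto
  have c: "c > 0" using \<zeta> Lpos by (simp add: c_def)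
  have \<gamma>: "\<gamma> t > 0" "\<gamma> t * \<zeta> = c" for t
    using \<zeta> Lpos step[of t] by (auto simp: c_def power2_eq_square)
  have desc: "U (Suc t) + ennreal c * G t \<le> U t" for t
    using sgd_expected_descent[where t = t and \<gamma> = \<gamma> and ?x0.0 = x0,
        OF n b diff smooth smooth_i quasar interp step \<gamma>(1) sampling iid] \<gamma>(2)[of t]
    by (simp add: U_def G_def X_def)
  have sum: "U j + (\<Sum>t<j. ennreal c * G t) \<le> U 0" for j
  proof (induction j)
    case (Suc j)
    have "U (Suc j) + (\<Sum>t<Suc j. ennreal c * G t) = (U (Suc j) + ennreal c * G j) + (\<Sum>t<j. ennreal c * G t)"
      by (simp add: ac_simps)
    also have "\<dots> \<le> U j + (\<Sum>t<j. ennreal c * G t)"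
      by (rule add_right_mono[OF desc])
    also have "\<dots> \<le> U 0"
      by (rule Suc.IH)
    finally show ?case .
  qed simp
  have Vm: "V j \<in> borel_measurable M" for j
    using iid by (auto simp: iid_copies_def indep_vars_def)
  have Xm[measurable]: "X t \<in> borel_measurable M" for t
    unfolding X_def by (intro borel_measurable_sgd diff Vm)
  have [measurable]: "average f \<in> borel_measurable borel"
    by (rule borel_measurable_average[OF diff])
  have U0: "U 0 = ennreal ((norm (x0 - xs))\<^sup>2)"
    by (simp add: U_def X_def emeasure_space_1)
  \<comment> \<open>Passing from the Bochner integral to \<open>G t\<close> needs no integrability:
    for infinite \<open>G t\<close> both \<open>expected_gap\<close> and
    \<open>enn2real (G t)\<close> default to 0, and the inequality still holds.\<close>
  have "ennreal m \<le> G t" if "t < k" for t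
  proof -
    have "m \<le> expected_gap M f xs X t"
      unfolding m_def using that by (intro Min_le) auto
    also have "\<dots> = enn2real (G t)"
      unfolding expected_gap_def G_def by (rule integral_eq_nn_integral)
        (auto simp: interpolation_average_le[OF interp])
    finally have "ennreal m \<le> ennreal (enn2real (G t))" by (rule ennreal_leI)
    also have "\<dots> \<le> G t" by (cases "G t") auto
    finally show ?thesis .
  qed
  then have "(\<Sum>t<k. ennreal c * ennreal m) \<le> (\<Sum>t<k. ennreal c * G t)"
    by (intro sum_mono mult_left_mono) auto
  also have "\<dots> \<le> U k + (\<Sum>t<k. ennreal c * G t)" by simp
  also have "\<dots> \<le> ennreal ((norm (x0 - xs))\<^sup>2)" using sum[of k] U0 by simp
  finally have "ennreal (real k * (c * m)) \<le> ennreal ((norm (x0 - xs))\<^sup>2)"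
    using c by (simp add: ennreal_mult' ennreal_of_nat_eq_real_of_nat)
  then have "real k * (c * m) \<le> (norm (x0 - xs))\<^sup>2"
    by (simp add: ennreal_le_iff)
  then have "m \<le> (norm (x0 - xs))\<^sup>2 / (real k * c)"
    using c k by (simp add: pos_le_divide_eq ac_simps)
  also have "\<dots> = ?L / \<zeta>\<^sup>2 * (2 * (norm (x0 - xs))\<^sup>2 / real k)"
    using \<zeta> Lpos by (simp add: c_def field_simps)
  finally show ?thesis by (simp add: m_def X_def)
qed

section \<open>Total complexity\<close>

text \<open>Solving the rate for \<open>k\<close> at accuracy \<open>\<epsilon>\<close> gives the
  parenthesized iteration count. Multiplying by \<open>b\<close> cancels the \<open>b\<close> in the
  denominator of \<open>expected_smoothness\<close>.\<close>

lemma complexity_bound_expected_smoothness: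
  assumes "b > 0" "n \<ge> 2"
  shows "complexity_bound n L Lmax \<zeta> r0 \<epsilon> b
    = real b * (expected_smoothness n b L Lmax / \<zeta>\<^sup>2 * (2 * r0 / \<epsilon>))"
  using assms by (simp add: complexity_bound_def expected_smoothness_def divide_simps)

text \<open>The bound is affine in \<open>b\<close>, and the sign of its slope is governed by
  \<open>(n - 1) L - 2 Lmax\<close>.\<close>

lemma complexity_bound_diff:
  "complexity_bound n L Lmax \<zeta> r0 \<epsilon> b - complexity_bound n L Lmax \<zeta> r0 \<epsilon> a
    = (real b - real a) * ((real n - 1) * L - 2 * Lmax) * (2 * r0 / \<epsilon> / (\<zeta>\<^sup>2 * (real n - 1)))"
  by (simp add: complexity_bound_def algebra_simps add_divide_distrib diff_divide_distrib)

text \<open>A nonnegative slope favors the left endpoint, a negative one the right. With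
  \<open>r0 = 0\<close> or at the threshold the bound is constant on \<open>{1..n}\<close>, so
  uniqueness is claimed only away from these cases.\<close>

lemma complexity_bound_arg_min:
  fixes n :: nat and L Lmax \<zeta> r0 \<epsilon> :: real
  defines "T \<equiv> complexity_bound n L Lmax \<zeta> r0 \<epsilon>"
    and "bs \<equiv> (if real n - 1 \<ge> 2 * Lmax / L then 1 else n)"
  assumes "n \<ge> 2" "L > 0" "\<epsilon> > 0" "\<zeta> > 0" "r0 \<ge> 0"
  shows "is_arg_min T (\<lambda>b. b \<in> {1..n}) bs"
    and "r0 > 0 \<Longrightarrow> real n - 1 \<noteq> 2 * Lmax / L \<Longrightarrow> is_arg_min T (\<lambda>b. b \<in> {1..n}) b \<Longrightarrow> b = bs"
proof -
  let ?s = "(real n - 1) * L - 2 * Lmax" and ?K = "2 * r0 / \<epsilon> / (\<zeta>\<^sup>2 * (real n - 1))"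
  have bs: "bs \<in> {1..n}" using assms by (auto simp: bs_def)
  have T: "T b - T bs = (real b - real bs) * ?s * ?K" for b
    unfolding T_def by (rule complexity_bound_diff)
  have K: "?K \<ge> 0" "r0 > 0 \<Longrightarrow> ?K > 0" using assms by auto
  have s: "real n - 1 \<ge> 2 * Lmax / L \<longleftrightarrow> ?s \<ge> 0" "real n - 1 = 2 * Lmax / L \<longleftrightarrow> ?s = 0"
    using \<open>L > 0\<close> by (auto simp: field_simps)
  \<comment> \<open>\<open>bs\<close> is the endpoint from which every other \<open>b\<close> lies
    in the direction of the sign of \<open>?s\<close>.\<close>
  have "0 \<le> (real b - real bs) * ?s" if "b \<in> {1..n}" for b
    using that s(1) by (auto simp: bs_def intro: mult_nonneg_nonneg mult_nonpos_nonpos)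
  then have ge: "T bs \<le> T b" if "b \<in> {1..n}" for b
    using T[of b] mult_nonneg_nonneg[OF _ K(1)] that by fastforce
  then show "is_arg_min T (\<lambda>b. b \<in> {1..n}) bs"
    using bs by (auto simp: is_arg_min_linorder)
  assume r0: "r0 > 0" and ne: "real n - 1 \<noteq> 2 * Lmax / L" and b: "is_arg_min T (\<lambda>b. b \<in> {1..n}) b"
  then have "T b = T bs"
    using ge bs by (force simp: is_arg_min_linorder)
  then have "(real b - real bs) * ?s * ?K = 0"
    using T[of b] by simp
  then show "b = bs"
    using K(2)[OF r0] ne s(2) by (metis mult_eq_0_iff less_irrefl of_nat_eq_iff eq_iff_diff_eq_0)
qed

theorem corollary4p2:
  fixes f :: "'n::finite \<Rightarrow> real^'d::finite \<Rightarrow> real"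
    and n b :: nat
    and L \<zeta> Lmax r0 :: real
    and Li :: "'n \<Rightarrow> real"
    and \<gamma> :: "nat \<Rightarrow> real"
    and x0 xs :: "real^'d"
    and N :: "'u measure" and v :: "'u \<Rightarrow> real^'n"
    and M :: "'w measure" and V :: "nat \<Rightarrow> 'w \<Rightarrow> real^'n"
    and X :: "nat \<Rightarrow> 'w \<Rightarrow> real^'d"
  assumes n: "n = CARD('n)" "n \<ge> 2"
    and diff: "\<forall>i x. f i differentiable (at x)"
    and smooth: "smooth_with L (average f)"
    and xs: "xs \<in> minimizers (average f)"
    and quasar: "quasar_convex \<zeta> (average f) xs"
    and interp: "interpolation f xs"
    and smooth_i: "\<forall>i. smooth_with (Li i) (f i)"
    and Lmax: "Lmax = Max (range Li)"
    and b: "1 \<le> b" "b \<le> n"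
    and sampling: "minibatch_sampling N b v"
    and iid: "iid_copies M V N v"
    and step: "\<forall>k. \<gamma> k = 1 / 2 * (\<zeta> * (real n - 1) * real b /
                 (2 * Lmax * (real n - real b) + L * (real n - 1) * real b))"
    and X: "\<forall>k w. X k w = sgd f \<gamma> x0 (\<lambda>j. V j w) k"
    and r0: "r0 = (norm (x0 - xs))\<^sup>2"
  shows "(\<forall>k\<ge>1. (MIN t\<in>{0..<k}. expected_gap M f xs X t)
             \<le> (2 * Lmax * (real n - real b) + L * (real n - 1) * real b) /
                 (\<zeta>\<^sup>2 * (real n - 1) * real b) * (2 * r0 / real k))
       \<and> (\<forall>\<epsilon>>0. \<forall>k\<ge>1. real (k * b) \<ge> complexity_bound n L Lmax \<zeta> r0 \<epsilon> b \<longrightarrow>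
             (MIN t\<in>{0..<k}. expected_gap M f xs X t) \<le> \<epsilon>)
       \<and> (\<forall>\<epsilon>>0. \<forall>bs. bs = (if real n - 1 \<ge> 2 * Lmax / L then 1 else n) \<longrightarrow>
             is_arg_min (complexity_bound n L Lmax \<zeta> r0 \<epsilon>) (\<lambda>b'. b' \<in> {1..n}) bs \<and>
             (r0 > 0 \<and> real n - 1 \<noteq> 2 * Lmax / L \<longrightarrow>
                (\<forall>b'. is_arg_min (complexity_bound n L Lmax \<zeta> r0 \<epsilon>) (\<lambda>b'. b' \<in> {1..n}) b' \<longrightarrow> b' = bs)))"
proof (intro conjI allI impI)
  have diff': "\<And>i x. f i differentiable (at x)" using diff by blast
  have smooth_i': "\<And>i. smooth_with (Li i) (f i)" "\<And>i. Li i \<le> Lmax"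
    using smooth_i Lmax by auto
  have L: "L > 0" using smooth by (simp add: smooth_with_def)
  have \<zeta>: "\<zeta> > 0" using quasar by (simp add: quasar_convex_def)
  have r0': "r0 \<ge> 0" using r0 by simp
  have X_eq: "X = (\<lambda>t w. sgd f \<gamma> x0 (\<lambda>j. V j w) t)" using X by blast
  have step': "\<gamma> t = \<zeta> / (2 * expected_smoothness CARD('n) b L Lmax)" for t
    using step by (simp add: expected_smoothness_def n(1) mult.assoc)
  have bound: "(MIN t\<in>{0..<k}. expected_gap M f xs X t)
      \<le> expected_smoothness n b L Lmax / \<zeta>\<^sup>2 * (2 * r0 / real k)" if "k \<ge> 1" for k
    using sgd_min_expected_gap[OF _ _ _ diff' smooth smooth_i' quasar interp step' sampling iid that,
        where ?x0.0 = x0] n b unfolding X_eq r0 by simp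
  show "(MIN t\<in>{0..<k}. expected_gap M f xs X t)
      \<le> (2 * Lmax * (real n - real b) + L * (real n - 1) * real b) / (\<zeta>\<^sup>2 * (real n - 1) * real b)
        * (2 * r0 / real k)" if "k \<ge> 1" for k
    using bound[OF that] by (simp add: expected_smoothness_def ac_simps)
  \<comment> \<open>For \<open>r0 = 0\<close> the complexity bound is 0 and would admit
    \<open>k = 0\<close>; \<open>k \<ge> 1\<close> keeps the set under \<open>MIN\<close> nonempty.
    The budget is divided by \<open>b\<close>, then \<open>\<epsilon>\<close> and \<open>k\<close>
    trade places to match the rate.\<close>
  show "(MIN t\<in>{0..<k}. expected_gap M f xs X t) \<le> \<epsilon>"
    if "\<epsilon> > 0" "k \<ge> 1" "complexity_bound n L Lmax \<zeta> r0 \<epsilon> b \<le> real (k * b)" for \<epsilon> k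
  proof -
    have "real b * (expected_smoothness n b L Lmax / \<zeta>\<^sup>2 * (2 * r0 / \<epsilon>)) \<le> real b * real k"
      using that(3) complexity_bound_expected_smoothness[of b n L Lmax \<zeta> r0 \<epsilon>] b n
      by (simp add: mult.commute)
    then have "expected_smoothness n b L Lmax / \<zeta>\<^sup>2 * (2 * r0 / \<epsilon>) \<le> real k"
      by (rule mult_left_le_imp_le) (use b in simp)
    then have "expected_smoothness n b L Lmax / \<zeta>\<^sup>2 * (2 * r0) \<le> \<epsilon> * real k"
      using that(1) by (simp only: times_divide_eq_right pos_divide_le_eq mult.commute[of \<epsilon>])
    then have "expected_smoothness n b L Lmax / \<zeta>\<^sup>2 * (2 * r0 / real k) \<le> \<epsilon>"
      using that(2) by (subst times_divide_eq_right, subst pos_divide_le_eq) auto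
    then show ?thesis
      using bound[OF that(2)] by linarith
  qed
  show "is_arg_min (complexity_bound n L Lmax \<zeta> r0 \<epsilon>) (\<lambda>b'. b' \<in> {1..n}) bs"
    if "\<epsilon> > 0" "bs = (if real n - 1 \<ge> 2 * Lmax / L then 1 else n)" for \<epsilon> bs
    unfolding that(2) by (rule complexity_bound_arg_min(1)[OF n(2) L that(1) \<zeta> r0'])
  show "b' = bs"
    if "\<epsilon> > 0" "bs = (if real n - 1 \<ge> 2 * Lmax / L then 1 else n)"
      "r0 > 0 \<and> real n - 1 \<noteq> 2 * Lmax / L"
      "is_arg_min (complexity_bound n L Lmax \<zeta> r0 \<epsilon>) (\<lambda>b'. b' \<in> {1..n}) b'" for \<epsilon> bs b'
    unfolding that(2) using that(3,4) by (intro complexity_bound_arg_min(2)[OF n(2) L that(1) \<zeta> r0']) auto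
qed

end
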